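(* Let $\mathcal{A}$ be a lazy stable paging algorithm. Let $\alpha=\alpha(k)$ divide $k$ with $\alpha<k$. Let $\delta=\delta(k)$ be such that $\delta \geq \sqrt{12\ln(k/\alpha)/\alpha}$ and $\delta\le 1/2$ for all $k$ large enough. Then $\alpha$-way set-associative $\mathcal{A}$ is $1$-competitive with $\mathcal{A}$ with probability $1-\exp(-\delta^2\alpha/24)$ using $(1-\delta)^{-1}$-resource augmentation on request sequences of length $O(\exp(\delta^2\alpha/24))$.
   Context: Paging: $\mathcal{U}$ is a universe of items; a request sequence is $\sigma\in\mathcal{U}^*$. For a paging algorithm $\mathcal{A}$ and cache size $k$, $\mathcal{A}_k$ denotes $\mathcal{A}$ run on a (initially empty) cache of $k$ slots; $C(\mathcal{A}_k,\sigma)$ is the number of cache misses of $\mathcal{A}_k$ on $\sigma$; $\mathcal{A}_k(\sigma)$ is the set of items cached after serving $\sigma$; $\sigma x$ is $\sigma$ followed by request $x$; $\textsf{Out}(\mathcal{A}_k,\sigma,x):=\mathcal{A}_k(\sigma)\setminus\mathcal{A}_k(\sigma x)$; for $X\subseteq\mathcal{U}$, $\sigma[X]$ is the subsequence of requests of $\sigma$ to items in $X$. A paging algorithm is lazy if it fetches an item only on a cache miss, evicts at most one item per miss, and evicts only when the cache is full. $\mathcal{A}$ is stable if for every $\tau\in\mathcal{U}^*$, $X\subseteq\mathcal{U}$, $z\in X$ and positive integers $a>b$: $\textsf{Out}(\mathcal{A}_b,\tau[X],z)\cap\mathcal{A}_a(\tau z)\neq\emptyset$ implies $\mathcal{A}_b(\tau[X]z)\subseteq\mathcal{A}_a(\tau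 z)$. $\alpha$-way set-associative $\mathcal{A}$ with cache size $k$ (with $\alpha\mid k$): pick a fully random hash function $h:\mathcal{U}\to[k/\alpha]$, partition the cache into $k/\alpha$ buckets of $\alpha$ slots, run an independent instance of $\mathcal{A}_\alpha$ on each bucket, and execute each request for $x$ on bucket $h(x)$. Competitiveness: $\mathcal{A}$ is $c$-competitive with $\mathcal{B}$ with probability $p$ using $r$-resource augmentation on request sequences of length $\ell$ if for every $\sigma$ with $|\sigma|\le \ell$, $\Pr[C(\mathcal{A}_k,\sigma)\le c\cdot C(\mathcal{B}_{k'},\sigma)+O(1)]\ge p$, where $k=rk'$; probability is over the algorithms' randomness (the hash function), and $\sigma$ is fixed in advance by an oblivious adversary. *)

theory Defs
  imports "HOL-Probability.Probability" "HOL-Library.Landau_Symbols"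
begin

text \<open>
  A deterministic online paging algorithm is represented by its cache contents:
  \<open>A k \<sigma>\<close> is the set of items cached after serving \<open>\<sigma>\<close> on an
  initially empty cache with \<open>k\<close> slots.
\<close>

type_synonym 'u paging = "nat \<Rightarrow> 'u list \<Rightarrow> 'u set"

definition paging_algorithm :: "'u paging \<Rightarrow> bool" where
  "paging_algorithm A \<longleftrightarrow>
     (\<forall>k>0. A k [] = {} \<and>
       (\<forall>\<sigma>. finite (A k \<sigma>) \<and> card (A k \<sigma>) \<le> k) \<and>
       (\<forall>\<sigma> x. x \<in> A k (\<sigma> @ [x])))"

definition Out :: "'u paging \<Rightarrow> nat \<Rightarrow> 'u list \<Rightarrow> 'u \<Rightarrow> 'u set" where
  "Out A k \<sigma> x = A k \<sigma> - A k (\<sigma> @ [x])"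

definition misses :: "'u paging \<Rightarrow> nat \<Rightarrow> 'u list \<Rightarrow> nat" where
  "misses A k \<sigma> = card {j. j < length \<sigma> \<and> \<sigma> ! j \<notin> A k (take j \<sigma>)}"

text \<open>
  The first conjunct says that an item enters the cache only by being requested while
  absent; in particular nothing is fetched on a hit.
\<close>

definition lazy_paging :: "'u paging \<Rightarrow> bool" where
  "lazy_paging A \<longleftrightarrow>
     (\<forall>k>0. \<forall>\<sigma> x.
       A k (\<sigma> @ [x]) - A k \<sigma> \<subseteq> {x} \<and>
       card (Out A k \<sigma> x) \<le> 1 \<and>
       (Out A k \<sigma> x \<noteq> {} \<longrightarrow> x \<notin> A k \<sigma> \<and> card (A k \<sigma>) = k))"

definition restrict_seq :: "'u list \<Rightarrow> 'u set \<Rightarrow> 'u list" where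
  "restrict_seq \<sigma> X = filter (\<lambda>y. y \<in> X) \<sigma>"

definition stable_paging :: "'u paging \<Rightarrow> bool" where
  "stable_paging A \<longleftrightarrow>
     (\<forall>\<tau> X z a b. z \<in> X \<longrightarrow> 0 < b \<longrightarrow> b < a \<longrightarrow>
       Out A b (restrict_seq \<tau> X) z \<inter> A a (\<tau> @ [z]) \<noteq> {} \<longrightarrow>
       A b (restrict_seq \<tau> X @ [z]) \<subseteq> A a (\<tau> @ [z]))"

text \<open>
  The bucket of index \<open>i\<close> runs its own instance of \<open>A\<close> on \<open>\<alpha>\<close> slots and sees exactly the
  requests hashed to \<open>i\<close>.
\<close>

definition bucket :: "'u paging \<Rightarrow> nat \<Rightarrow> ('u \<Rightarrow> nat) \<Rightarrow> 'u list \<Rightarrow> nat \<Rightarrow> 'u set" where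
  "bucket A \<alpha> h \<sigma> i = A \<alpha> (restrict_seq \<sigma> {y. h y = i})"

definition set_assoc_misses :: "'u paging \<Rightarrow> nat \<Rightarrow> ('u \<Rightarrow> nat) \<Rightarrow> 'u list \<Rightarrow> nat" where
  "set_assoc_misses A \<alpha> h \<sigma> =
     card {j. j < length \<sigma> \<and> \<sigma> ! j \<notin> bucket A \<alpha> h (take j \<sigma>) (h (\<sigma> ! j))}"

text \<open>
  Fully random hash functions into \<open>m\<close> buckets: independent uniform values; the universe
  may be infinite.
\<close>

definition random_hash :: "nat \<Rightarrow> ('u \<Rightarrow> nat) measure" where
  "random_hash m = PiM UNIV (\<lambda>_. uniform_count_measure {..<m})"

text \<open>
  Large cache sizes within a set \<open>K\<close> of admissible ones. Restricting to \<open>K\<close> matters for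
  conditions such as \<open>\<alpha> k dvd k\<close>, which force \<open>\<alpha> k = 1\<close> for every prime \<open>k\<close> when
  \<open>\<alpha> k < k\<close>.
\<close>

abbreviation large_in :: "nat set \<Rightarrow> nat filter" where
  "large_in K \<equiv> inf at_top (principal K)"

text \<open>
  \<open>costA k \<omega> \<sigma>\<close> is the cost with cache size \<open>k\<close> and random choices \<open>\<omega>\<close> drawn from \<open>M k\<close>;
  \<open>costB\<close> is the cost of a deterministic competitor, whose cache size is \<open>k / r k\<close> rounded
  down. The additive constant \<open>d\<close> is uniform in the cache size and the request sequence.
\<close>

definition competitive ::
  "nat set \<Rightarrow> (nat \<Rightarrow> 'w measure) \<Rightarrow> (nat \<Rightarrow> 'w \<Rightarrow> 'u list \<Rightarrow> nat) \<Rightarrow>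
   (nat \<Rightarrow> 'u list \<Rightarrow> nat) \<Rightarrow> real \<Rightarrow> (nat \<Rightarrow> real) \<Rightarrow> (nat \<Rightarrow> real) \<Rightarrow>
   (nat \<Rightarrow> real) \<Rightarrow> bool" where
  "competitive K M costA costB c p r l \<longleftrightarrow>
     (\<exists>d::real. \<forall>\<^sub>F k in large_in K. \<forall>\<sigma>. real (length \<sigma>) \<le> l k \<longrightarrow>
        measure (M k) {\<omega> \<in> space (M k).
          real (costA k \<omega> \<sigma>) \<le> c * real (costB (nat \<lfloor>real k / r k\<rfloor>) \<sigma>) + d} \<ge> p k)"

end

theory Submission
  imports Defs
begin

text \<open>
  Stability makes \<open>A\<close> a stack algorithm: a larger cache contains a smaller one, so cost is
  antitone in the cache size. It also implies that, as long as at no time more than \<open>b\<close> items of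
  the fully associative cache \<open>A a\<close> (with \<open>b < a\<close>) hash to the same bucket, every bucket contains
  all items of \<open>A a\<close> hashing to it: a premature eviction from a bucket would force the whole
  full bucket together with the evicted item, that is \<open>b + 1\<close> items, into \<open>A a\<close>. Without overflow the
  set-associative cache hence misses at most when \<open>A a\<close> does.

  The competitor's cache does not depend on the hash function, so a Chernoff bound shows that
  a fixed bucket overflows at a fixed time with probability at most \<open>exp (- \<delta>\<^sup>2 * b / 2)\<close>. A union
  bound over times and buckets finishes the proof if \<open>exp (\<delta>\<^sup>2 * b / 24)\<close> exceeds the constant \<open>C\<close>
  hidden in the bound on the length; otherwise the length is at most \<open>C\<^sup>2\<close>, which the additive
  constant absorbs.
\<close>

section \<open>Lazy stable paging: inclusion of caches and comparison with buckets\<close>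

locale lazy_stable_paging =
  fixes A :: "'u paging"
  assumes paging: "paging_algorithm A"
    and lazy: "lazy_paging A"
    and stable: "stable_paging A"
begin

lemma cache_Nil: "k > 0 \<Longrightarrow> A k [] = {}"
  and finite_cache: "k > 0 \<Longrightarrow> finite (A k \<sigma>)"
  and card_cache_le: "k > 0 \<Longrightarrow> card (A k \<sigma>) \<le> k"
  and requested_in_cache: "k > 0 \<Longrightarrow> x \<in> A k (\<sigma> @ [x])"
  using paging by (auto simp: paging_algorithm_def)

lemma cache_snoc:
  assumes "k > 0"
  shows "A k (\<sigma> @ [x]) = insert x (A k \<sigma> - Out A k \<sigma> x)"
proof -
  have "A k (\<sigma> @ [x]) - A k \<sigma> \<subseteq> {x}"
    using lazy assms by (simp add: lazy_paging_def)
  then show ?thesis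
    using requested_in_cache[OF assms, of x \<sigma>] by (auto simp: Out_def)
qed

lemma eviction:
  assumes "k > 0" "y \<in> Out A k \<sigma> x"
  shows "Out A k \<sigma> x = {y}" "x \<notin> A k \<sigma>" "card (A k \<sigma>) = k" "card (A k (\<sigma> @ [x])) = k"
proof -
  have l: "card (Out A k \<sigma> x) \<le> 1" "x \<notin> A k \<sigma>" "card (A k \<sigma>) = k"
    using lazy assms by (auto simp: lazy_paging_def)
  have fin: "finite (A k \<sigma>)" "finite (Out A k \<sigma> x)"
    using finite_cache[OF assms(1)] by (auto simp: Out_def)
  show 1: "Out A k \<sigma> x = {y}"
    using l(1) assms(2) fin by (auto simp: card_le_Suc0_iff_eq)
  show "x \<notin> A k \<sigma>" "card (A k \<sigma>) = k" using l by auto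
  have "y \<in> A k \<sigma>" using assms(2) by (simp add: Out_def)
  then show "card (A k (\<sigma> @ [x])) = k"
    unfolding cache_snoc[OF assms(1)] 1 using l fin assms(1) by simp
qed

lemma cache_subset_requests: "k > 0 \<Longrightarrow> A k \<sigma> \<subseteq> set \<sigma>"
proof (induction \<sigma> rule: rev_induct)
  case (snoc x \<sigma>)
  then show ?case by (auto simp: cache_snoc)
qed (simp add: cache_Nil)

text \<open>By laziness an eviction leaves the cache full, and no request shrinks the cache. So a
  cache below capacity has never evicted and still holds everything requested.\<close>

lemma cache_not_full:
  assumes "k > 0"
  shows "card (A k \<sigma>) < k \<Longrightarrow> A k \<sigma> = set \<sigma>"
proof (induction \<sigma> rule: rev_induct)
  case (snoc x \<sigma>)
  have "Out A k \<sigma> x = {}"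
    using eviction(4)[OF assms, of _ \<sigma> x] snoc.prems by fastforce
  then have eq: "A k (\<sigma> @ [x]) = insert x (A k \<sigma>)"
    using cache_snoc[OF assms] by simp
  moreover have "card (A k \<sigma>) \<le> card (insert x (A k \<sigma>))"
    by (intro card_mono) (auto simp: finite_cache assms)
  ultimately show ?case using snoc by simp
qed (simp add: cache_Nil assms)

text \<open>In a first violation the larger cache evicts some \<open>y\<close> that the smaller one
  keeps, so the larger one is full and misses. By induction the smaller one misses too, and it is
  full, so it evicts some \<open>w\<close> other than \<open>y\<close>. The larger cache evicts only
  \<open>y\<close> and hence keeps \<open>w\<close>; stability with \<open>X = UNIV\<close> then
  gives the inclusion.\<close>

lemma cache_mono:
  assumes "0 < b" "b < a"
  shows "A b \<sigma> \<subseteq> A a \<sigma>"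
proof (induction \<sigma> rule: rev_induct)
  case Nil
  then show ?case using assms by (simp add: cache_Nil)
next
  case (snoc z \<sigma>)
  have a: "0 < a" using assms by simp
  show ?case
  proof (rule ccontr)
    assume not_sub: "\<not> A b (\<sigma> @ [z]) \<subseteq> A a (\<sigma> @ [z])"
    then obtain y where y: "y \<in> A b (\<sigma> @ [z])" "y \<notin> A a (\<sigma> @ [z])" by blast
    then have "y \<in> A b \<sigma>" 
      using requested_in_cache[OF a, of z \<sigma>] by (auto simp: cache_snoc[OF assms(1)])
    then have yOut: "y \<in> Out A a \<sigma> z" using y snoc.IH by (auto simp: Out_def)
    note ev = eviction[OF a yOut]
    \<comment> \<open>A smaller cache that is not full would hold all requested items, among them
      the \<open>a > b\<close> items of the full larger cache.\<close>
    have "card (A b \<sigma>) = b"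
    proof (rule ccontr)
      assume "card (A b \<sigma>) \<noteq> b"
      then have less: "card (A b \<sigma>) < b" using card_cache_le[OF assms(1), of \<sigma>] by simp
      then have "A a \<sigma> \<subseteq> A b \<sigma>"
        using cache_not_full[OF assms(1)] cache_subset_requests[OF a] by blast
      then have "card (A a \<sigma>) \<le> card (A b \<sigma>)"
        using finite_cache[OF assms(1)] by (rule card_mono[rotated])
      then show False using less ev(3) assms by simp
    qed
    moreover have "z \<notin> A b \<sigma>" using ev(2) snoc.IH by blast
    moreover have "card (A b (\<sigma> @ [z])) \<le> b" using card_cache_le[OF assms(1)] .
    ultimately have "Out A b \<sigma> z \<noteq> {}"
      using cache_snoc[OF assms(1), of \<sigma> z] finite_cache[OF assms(1), of \<sigma>] by auto
    then obtain w where w: "w \<in> Out A b \<sigma> z" by blast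
    then have "w \<noteq> y" "w \<in> A a \<sigma>" using y snoc.IH by (auto simp: Out_def)
    then have "w \<in> A a (\<sigma> @ [z])" using ev(1) by (auto simp: Out_def)
    then have "A b (\<sigma> @ [z]) \<subseteq> A a (\<sigma> @ [z])"
      using stable[unfolded stable_paging_def, rule_format, of z UNIV b a \<sigma>] w assms
      by (auto simp: restrict_seq_def)
    then show False using not_sub by blast
  qed
qed

lemma misses_antimono:
  assumes "0 < b" "b \<le> a"
  shows "misses A a \<sigma> \<le> misses A b \<sigma>"
proof (cases "b = a")
  case False
  then have "A b \<tau> \<subseteq> A a \<tau>" for \<tau> using assms by (intro cache_mono) auto
  then show ?thesis unfolding misses_def by (intro card_mono) auto
qed simp

lemma cache_subset_bucket:
  assumes "0 < b" "b < a"
  shows "(\<And>j. j \<le> length \<tau> \<Longrightarrow> card (A a (take j \<tau>) \<inter> X) \<le> b) \<Longrightarrow>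
    A a \<tau> \<inter> X \<subseteq> A b (restrict_seq \<tau> X)"
proof (induction \<tau> rule: rev_induct)
  case Nil
  then show ?case using assms by (simp add: cache_Nil)
next
  case (snoc z \<tau>)
  have a: "0 < a" using assms by simp
  have IH: "A a \<tau> \<inter> X \<subseteq> A b (restrict_seq \<tau> X)"
  proof (rule snoc.IH)
    fix j assume "j \<le> length \<tau>"
    then show "card (A a (take j \<tau>) \<inter> X) \<le> b" using snoc.prems[of j] by simp
  qed
  show ?case
  proof (cases "z \<in> X")
    case False
    then show ?thesis using IH by (auto simp: restrict_seq_def cache_snoc[OF a])
  next
    case True
    have rs: "restrict_seq (\<tau> @ [z]) X = restrict_seq \<tau> X @ [z]"
      using True by (simp add: restrict_seq_def)
    \<comment> \<open>Both caches gain only \<open>z\<close>, so the inclusion can fail only if the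
      bucket evicts an item that \<open>A a\<close> retains.\<close>
    have "Out A b (restrict_seq \<tau> X) z \<inter> A a (\<tau> @ [z]) = {}"
    proof (rule ccontr)
      assume ne: "Out A b (restrict_seq \<tau> X) z \<inter> A a (\<tau> @ [z]) \<noteq> {}"
      then obtain y where y: "y \<in> Out A b (restrict_seq \<tau> X) z" "y \<in> A a (\<tau> @ [z])" by blast
      let ?B = "A b (restrict_seq \<tau> X @ [z])"
      have "?B \<subseteq> A a (\<tau> @ [z])"
        using stable True assms ne unfolding stable_paging_def by blast
      moreover have "?B \<subseteq> X" "y \<in> X"
        using cache_subset_requests[OF assms(1), of "restrict_seq \<tau> X"]
          cache_subset_requests[OF assms(1), of "restrict_seq \<tau> X @ [z]"] True y(1)
        by (auto simp: Out_def restrict_seq_def)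
      ultimately have "insert y ?B \<subseteq> A a (\<tau> @ [z]) \<inter> X" using y by blast
      then have "card (insert y ?B) \<le> card (A a (\<tau> @ [z]) \<inter> X)"
        by (intro card_mono) (auto simp: finite_cache[OF a])
      moreover have "y \<notin> ?B" using y(1) by (simp add: Out_def)
      then have "card (insert y ?B) = Suc b"
        using eviction(4)[OF assms(1) y(1)] finite_cache[OF assms(1)] by simp
      ultimately show False using snoc.prems[of "length (\<tau> @ [z])"] by simp
    qed
    then show ?thesis
      unfolding rs using IH by (auto simp: cache_snoc[OF a] cache_snoc[OF assms(1)])
  qed
qed

text \<open>Whether a request misses depends on the caches just before it. Proper prefixes and
  attained hash values therefore suffice, which leaves finitely many overflow events for the union
  bound.\<close>

lemma set_assoc_misses_le_misses:
  assumes "0 < b" "b < a"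
    and "\<And>j i. j < length \<sigma> \<Longrightarrow> i \<in> h ` UNIV \<Longrightarrow> card (A a (take j \<sigma>) \<inter> {y. h y = i}) \<le> b"
  shows "set_assoc_misses A b h \<sigma> \<le> misses A a \<sigma>"
  unfolding set_assoc_misses_def misses_def
proof (intro card_mono subsetI)
  fix j assume "j \<in> {j. j < length \<sigma> \<and> \<sigma> ! j \<notin> bucket A b h (take j \<sigma>) (h (\<sigma> ! j))}"
  then have j: "j < length \<sigma>" "\<sigma> ! j \<notin> bucket A b h (take j \<sigma>) (h (\<sigma> ! j))" by auto
  have "A a (take j \<sigma>) \<inter> {y. h y = h (\<sigma> ! j)} \<subseteq> A b (restrict_seq (take j \<sigma>) {y. h y = h (\<sigma> ! j)})"
    using assms j(1) by (intro cache_subset_bucket) auto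
  then show "j \<in> {j. j < length \<sigma> \<and> \<sigma> ! j \<notin> A a (take j \<sigma>)}"
    using j by (auto simp: bucket_def)
qed simp

end

section \<open>Dependence of the set-associative cost on the hash values\<close>

lemma set_assoc_misses_le_length: "set_assoc_misses A b h \<sigma> \<le> length \<sigma>"
  unfolding set_assoc_misses_def
  using card_mono[of "{..<length \<sigma>}" "{j. j < length \<sigma> \<and> \<sigma> ! j \<notin> bucket A b h (take j \<sigma>) (h (\<sigma> ! j))}"]
  by auto

text \<open>Only the hash values of requested items matter; this makes events about the cost
  measurable.\<close>

lemma set_assoc_misses_cong:
  assumes "map h \<sigma> = map h' \<sigma>"
  shows "set_assoc_misses A b h \<sigma> = set_assoc_misses A b h' \<sigma>"
proof -
  have eq: "h x = h' x" if "x \<in> set \<sigma>" for x using assms that by simp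
  have "restrict_seq (take j \<sigma>) {y. h y = h (\<sigma> ! j)} = restrict_seq (take j \<sigma>) {y. h' y = h' (\<sigma> ! j)}"
    if "j < length \<sigma>" for j
    unfolding restrict_seq_def using that by (intro filter_cong) (auto simp: eq dest: in_set_takeD)
  then show ?thesis
    unfolding set_assoc_misses_def bucket_def by (intro arg_cong[where f = card] Collect_cong) auto
qed

section \<open>Random hash functions: measurability and tail bounds for bucket loads\<close>

lemma space_random_hash: "space (random_hash m) = UNIV \<rightarrow> {..<m}"
  by (auto simp: random_hash_def space_PiM space_uniform_count_measure PiE_def)

text \<open>Restrictions of hash functions to the finite set \<open>S\<close> take finitely many
  values, so the event is a finite union of cylinders. This works for a universe of any
  cardinality.\<close>

lemma sets_random_hash_finite_support:
  assumes "finite S" and "\<And>h h'. (\<And>x. x \<in> S \<Longrightarrow> h x = h' x) \<Longrightarrow> P h = P h'"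
  shows "{h \<in> space (random_hash m). P h} \<in> sets (random_hash m)"
proof -
  let ?M = "random_hash m"
  let ?G = "(\<lambda>h. restrict h S) ` {h \<in> space ?M. P h}"
  have eq: "{h \<in> space ?M. P h} = (\<Union>g\<in>?G. {h \<in> space ?M. \<forall>x\<in>S. h x = g x})"
  proof (intro set_eqI iffI)
    fix h assume "h \<in> (\<Union>g\<in>?G. {h \<in> space ?M. \<forall>x\<in>S. h x = g x})"
    then obtain h' where "P h'" "h \<in> space ?M" "\<forall>x\<in>S. h x = h' x" by auto
    then show "h \<in> {h \<in> space ?M. P h}" using assms(2)[of h h'] by auto
  qed auto
  moreover have "finite ?G"
  proof (rule finite_subset)
    show "?G \<subseteq> S \<rightarrow>\<^sub>E {..<m}" by (auto simp: space_random_hash)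
    show "finite (S \<rightarrow>\<^sub>E {..<m})" using assms(1) by (intro finite_PiE) auto
  qed
  moreover have "{h \<in> space ?M. \<forall>x\<in>S. h x = g x} \<in> sets ?M" for g
  proof (rule sets.sets_Collect_finite_All[OF _ assms(1)])
    fix x
    have "{n \<in> {..<m}. n = g x} \<in> Pow {..<m}" by auto
    then show "{h \<in> space ?M. h x = g x} \<in> sets ?M"
      unfolding random_hash_def
      by (intro sets_Collect_single') (auto simp: space_uniform_count_measure sets_uniform_count_measure)
  qed
  ultimately show ?thesis by (subst eq) (rule sets.finite_UN)
qed

context
  fixes m :: nat
  assumes m: "m > 0"
begin

lemma prob_space_random_hash: "prob_space (random_hash m)"
  unfolding random_hash_def
  using m by (intro prob_space_PiM prob_space_uniform_count_measure) auto

text \<open>The integrand factors through the restriction to \<open>S\<close>, whose distribution is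
  a finite product measure, and there the expectation factorises by independence.\<close>

lemma integral_random_hash_prod:
  fixes f :: "nat \<Rightarrow> real"
  assumes "finite S"
  shows "(\<integral>h. (\<Prod>x\<in>S. f (h x)) \<partial>random_hash m) = ((\<Sum>n<m. f n) / m) ^ card S"
    and "integrable (random_hash m) (\<lambda>h. \<Prod>x\<in>S. f (h x))"
proof -
  let ?U = "uniform_count_measure {..<m}"
  let ?M = "\<lambda>_::'a. ?U"
  interpret U: prob_space ?U using m by (intro prob_space_uniform_count_measure) auto
  interpret P: product_prob_space ?M UNIV by unfold_locales
  have int: "integrable ?U f"
    unfolding uniform_count_measure_def by (simp add: integrable_point_measure_finite)
  have meas: "(\<lambda>g. \<Prod>x\<in>S. f (g x)) \<in> borel_measurable (PiM S ?M)"
    using int by (auto intro!: borel_measurable_prod measurable_compose[OF measurable_component_singleton])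
  have restr: "(\<lambda>h. restrict h S) \<in> random_hash m \<rightarrow>\<^sub>M PiM S ?M"
    unfolding random_hash_def by (rule measurable_restrict_subset) simp
  have D: "distr (random_hash m) (PiM S ?M) (\<lambda>h. restrict h S) = PiM S ?M"
    unfolding random_hash_def using P.distr_PiM_restrict_finite[OF assms] by simp
  have eq: "(\<Prod>x\<in>S. f (restrict h S x)) = (\<Prod>x\<in>S. f (h x))" for h
    by (intro prod.cong) auto
  show "(\<integral>h. (\<Prod>x\<in>S. f (h x)) \<partial>random_hash m) = ((\<Sum>n<m. f n) / m) ^ card S"
    using integral_distr[OF restr meas] P.product_integral_prod[OF assms, of "\<lambda>_. f"] int
    unfolding D eq by (simp add: integral_uniform_count_measure)
  show "integrable (random_hash m) (\<lambda>h. \<Prod>x\<in>S. f (h x))"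
    using integrable_distr_eq[OF restr meas] P.product_integrable_prod[OF assms, of "\<lambda>_. f"] int
    unfolding D eq by simp
qed

lemma bucket_load_tail:
  fixes t :: real
  assumes "finite S" "i < m" "t \<ge> 1"
  shows "measure (random_hash m) {h \<in> space (random_hash m). card {x \<in> S. h x = i} \<ge> b}
    \<le> exp (card S * (t - 1) / m) / t ^ b"
proof -
  let ?M = "random_hash m :: ('a \<Rightarrow> nat) measure"
  interpret prob_space ?M by (rule prob_space_random_hash)
  \<comment> \<open>The product of \<open>f (h x)\<close> over \<open>S\<close> is \<open>t\<close>
    to the power of the load of bucket \<open>i\<close>, to which Markov's inequality is
    applied.\<close>
  define f where "f n = (if n = i then t else 1)" for n
  have f_prod: "(\<Prod>x\<in>S. f (h x)) = t ^ card {x \<in> S. h x = i}" for h :: "'a \<Rightarrow> nat"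
    using assms(1) by (simp add: f_def prod.If_cases Int_def)
  have "(\<Sum>n<m. f n) = (\<Sum>n<m. 1 + (if n = i then t - 1 else 0))"
    by (intro sum.cong) (auto simp: f_def)
  also have "\<dots> = m + (t - 1)" using assms(2) by (simp add: sum.distrib)
  finally have mean: "(\<Sum>n<m. f n) / m = 1 + (t - 1) / m" using m by (simp add: field_simps)
  have int: "integrable ?M (\<lambda>h. t ^ card {x \<in> S. h x = i})"
    using integral_random_hash_prod(2)[OF assms(1), of f] by (simp add: f_prod)
  have "{h \<in> space ?M. card {x \<in> S. h x = i} \<ge> b} \<subseteq> {h \<in> space ?M. t ^ card {x \<in> S. h x = i} \<ge> t ^ b}"
    using assms(3) by (auto intro: power_increasing)
  then have "prob {h \<in> space ?M. card {x \<in> S. h x = i} \<ge> b}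
      \<le> prob {h \<in> space ?M. t ^ card {x \<in> S. h x = i} \<ge> t ^ b}"
    using int by (intro finite_measure_mono) auto
  also have "\<dots> \<le> (\<integral>h. t ^ card {x \<in> S. h x = i} \<partial>?M) / t ^ b"
    using assms(3) int by (intro integral_Markov_inequality_measure[where A = "{}"]) auto
  also have "(\<integral>h. t ^ card {x \<in> S. h x = i} \<partial>?M) = (1 + (t - 1) / m) ^ card S"
    using integral_random_hash_prod(1)[OF assms(1), of f] by (simp add: f_prod mean)
  also have "\<dots> \<le> exp ((t - 1) / m) ^ card S"
    using assms(3) by (intro power_mono exp_ge_add_one_self) auto
  also have "\<dots> = exp (card S * (t - 1) / m)"
    by (simp add: exp_of_nat_mult[symmetric])
  finally show ?thesis using assms(3) by (simp add: divide_right_mono)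
qed

end

text \<open>The difference of the two sides vanishes at 0 and has derivative y^2 / (1 - y). The
  quadratic term is what survives in the exponent of the overflow bound.\<close>

lemma ln_one_minus_le:
  fixes x :: real
  assumes "0 \<le> x" "x < 1"
  shows "ln (1 - x) \<le> - x - x\<^sup>2 / 2"
proof -
  let ?f = "\<lambda>x::real. - x - x\<^sup>2 / 2 - ln (1 - x)"
  have "?f 0 \<le> ?f x"
  proof (rule DERIV_nonneg_imp_nondecreasing[OF assms(1)])
    fix y assume y: "0 \<le> y" "y \<le> x"
    have "(?f has_real_derivative (- 1 - y + 1 / (1 - y))) (at y)"
      using y assms by (auto intro!: derivative_eq_intros simp: field_simps)
    moreover have "- 1 - y + 1 / (1 - y) \<ge> 0"
      using y assms by (simp add: field_simps)
    ultimately show "\<exists>D. (?f has_real_derivative D) (at y) \<and> 0 \<le> D" by blast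
  qed
  then show ?thesis by simp
qed

text \<open>
  The slack of one slot in the bound on \<open>card S\<close> is paid for by \<open>Suc b\<close>
  in place of \<open>b\<close> in the event.
\<close>

lemma bucket_overflow:
  fixes \<delta> :: real
  assumes "m \<ge> 2" "0 \<le> \<delta>" "\<delta> \<le> 1 / 2" "finite S" "i < m"
    and "card S \<le> (1 - \<delta>) * (m * b) + 1"
  shows "measure (random_hash m) {h \<in> space (random_hash m). card {x \<in> S. h x = i} > b}
    \<le> exp (- (\<delta>\<^sup>2 * b / 2))"
proof -
  \<comment> \<open>This is the ratio of the capacity \<open>b\<close> to a mean load of
    \<open>(1 - \<delta>) * b\<close>, the minimiser of the Chernoff bound for that mean.\<close>
  define t where "t = 1 / (1 - \<delta>)"
  have t: "t \<ge> 1" "t > 0" "t - 1 = \<delta> / (1 - \<delta>)" using assms by (auto simp: t_def field_simps)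
  have "card S * (t - 1) / m \<le> ((1 - \<delta>) * (m * b) + 1) * (t - 1) / m"
    using assms t(1) by (intro divide_right_mono mult_right_mono) auto
  also have "\<dots> = \<delta> * b + \<delta> / ((1 - \<delta>) * m)"
    using assms unfolding t(3) by (simp add: field_simps)
  \<comment> \<open>With at least two buckets and \<open>\<delta> \<le> 1 / 2\<close>, the surplus
    item adds at most \<open>\<delta>\<close> to the exponent.\<close>
  also have "\<delta> / ((1 - \<delta>) * m) \<le> \<delta> / 1"
  proof (intro divide_left_mono)
    have "(1/2) * 2 \<le> (1 - \<delta>) * real m" using assms by (intro mult_mono) auto
    then show "1 \<le> (1 - \<delta>) * m" by simp
  qed (use assms in auto)
  finally have 1: "card S * (t - 1) / m \<le> \<delta> * Suc b" by (simp add: algebra_simps)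
  have "ln (1 - \<delta>) * Suc b \<le> (- \<delta> - \<delta>\<^sup>2 / 2) * Suc b"
    using assms by (intro mult_right_mono ln_one_minus_le) auto
  also have "\<dots> = - (\<delta> * Suc b) - \<delta>\<^sup>2 * b / 2 - \<delta>\<^sup>2 / 2"
    by (simp add: algebra_simps)
  finally have 2: "\<delta> * Suc b + ln (1 - \<delta>) * Suc b \<le> - (\<delta>\<^sup>2 * b / 2)"
    using zero_le_power2[of \<delta>] by linarith
  have "exp (ln (1 - \<delta>) * Suc b) = (1 - \<delta>) ^ Suc b"
    using assms by (subst exp_of_nat2_mult) simp
  then have "t ^ Suc b = exp (- (ln (1 - \<delta>) * Suc b))"
    unfolding exp_minus by (simp add: t_def power_one_over inverse_eq_divide del: power_Suc)
  then have "exp (card S * (t - 1) / m) / t ^ Suc b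
      = exp (card S * (t - 1) / m + ln (1 - \<delta>) * Suc b)"
    by (simp only: exp_diff[symmetric] diff_minus_eq_add)
  also have "\<dots> \<le> exp (- (\<delta>\<^sup>2 * b / 2))" using 1 2 by simp
  finally show ?thesis
    using bucket_load_tail[of m S i t "Suc b"] assms t by (simp add: Suc_le_eq)
qed

section \<open>Union bound over times and buckets\<close>

context lazy_stable_paging
begin

lemma set_assoc_competitive:
  fixes \<delta> :: real
  assumes "m \<ge> 2" "b > 0" "0 \<le> \<delta>" "\<delta> \<le> 1 / 2" "0 \<le> d"
  defines "k' \<equiv> nat \<lfloor>(1 - \<delta>) * (m * b)\<rfloor>"
  shows "measure (random_hash m) {h \<in> space (random_hash m).
      real (set_assoc_misses A b h \<sigma>) \<le> real (misses A k' \<sigma>) + d}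
    \<ge> 1 - real (length \<sigma>) * real m * exp (- (\<delta>\<^sup>2 * b / 2))"
proof -
  let ?M = "random_hash m :: ('u \<Rightarrow> nat) measure"
  interpret prob_space ?M using assms by (intro prob_space_random_hash) auto
  \<comment> \<open>For \<open>m = 2\<close> and \<open>\<delta>\<close> near 1/2 the competitor may have only \<open>b\<close> slots, where stability
    says nothing; one extra slot only helps it.\<close>
  define a where "a = max k' (Suc b)"
  have "(1/2) * (2 * real b) \<le> (1 - \<delta>) * (real m * real b)"
    using assms by (intro mult_mono) auto
  then have "of_int (int b) \<le> (1 - \<delta>) * (real m * real b)" by simp
  then have "int b \<le> \<lfloor>(1 - \<delta>) * (real m * real b)\<rfloor>" by (simp only: le_floor_iff)
  then have bk': "b \<le> k'" by (simp add: k'_def nat_le_iff le_nat_iff)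
  have "real k' \<le> (1 - \<delta>) * (m * b)" using assms by (simp add: k'_def)
  \<comment> \<open>Since \<open>b \<le> k'\<close>, the cache size \<open>a\<close> exceeds
    \<open>k'\<close> by at most one, the surplus that \<open>bucket_overflow\<close>
    tolerates.\<close>
  then have a_le: "real a \<le> (1 - \<delta>) * (m * b) + 1" using bk' by (simp add: a_def)
  have a: "0 < a" "b < a" "k' \<le> a" by (auto simp: a_def)
  define S where "S j = A a (take j \<sigma>)" for j
  have finS: "finite (S j)" for j using finite_cache[OF a(1)] by (simp add: S_def)
  have cardS: "real (card (S j)) \<le> (1 - \<delta>) * (m * b) + 1" for j
    using card_cache_le[OF a(1), of "take j \<sigma>"] a_le by (simp add: S_def)
  define B where "B j i = {h \<in> space ?M. card {x \<in> S j. h x = i} > b}" for j i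
  define Bad where "Bad = (\<Union>(j, i)\<in>{..<length \<sigma>} \<times> {..<m}. B j i)"
  have B_sets: "B j i \<in> sets ?M" for j i
    unfolding B_def
    by (rule sets_random_hash_finite_support[OF finS[of j]]) (auto cong: conj_cong)
  then have Bad_sets: "Bad \<in> sets ?M" by (auto simp: Bad_def)
  have "prob Bad \<le> (\<Sum>(j, i)\<in>{..<length \<sigma>} \<times> {..<m}. prob (B j i))"
    unfolding Bad_def case_prod_unfold
    by (intro finite_measure_subadditive_finite) (auto simp: B_sets)
  also have "\<dots> \<le> (\<Sum>(j, i)\<in>{..<length \<sigma>} \<times> {..<m}. exp (- (\<delta>\<^sup>2 * b / 2)))"
    unfolding B_def case_prod_unfold
    using assms cardS by (intro sum_mono bucket_overflow finS) auto
  also have "\<dots> = real (length \<sigma>) * real m * exp (- (\<delta>\<^sup>2 * b / 2))" by simp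
  finally have Bad: "prob Bad \<le> real (length \<sigma>) * real m * exp (- (\<delta>\<^sup>2 * b / 2))" .
  let ?G = "{h \<in> space ?M. real (set_assoc_misses A b h \<sigma>) \<le> real (misses A k' \<sigma>) + d}"
  have "set_assoc_misses A b h \<sigma> \<le> misses A k' \<sigma>" if h: "h \<in> space ?M" "h \<notin> Bad" for h
  proof -
    have "set_assoc_misses A b h \<sigma> \<le> misses A a \<sigma>"
    proof (intro set_assoc_misses_le_misses assms a)
      fix j i assume "j < length \<sigma>" "i \<in> range h"
      then have "h \<notin> B j i" using h by (auto simp: Bad_def space_random_hash)
      then show "card (A a (take j \<sigma>) \<inter> {y. h y = i}) \<le> b"
        using h(1) by (simp add: B_def S_def Int_def)
    qed
    also have "\<dots> \<le> misses A k' \<sigma>" using bk' assms(2) a(3) by (intro misses_antimono) linarith+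
    finally show ?thesis .
  qed
  then have "space ?M - Bad \<subseteq> ?G" using assms(5) by fastforce
  \<comment> \<open>Monotonicity of the measure needs this: a nonmeasurable set would have measure 0
    by convention.\<close>
  moreover have "?G \<in> sets ?M"
    by (rule sets_random_hash_finite_support[of "set \<sigma>"])
      (auto cong: set_assoc_misses_cong map_cong)
  ultimately have "prob (space ?M - Bad) \<le> prob ?G" by (rule finite_measure_mono)
  then show ?thesis using prob_compl[OF Bad_sets] Bad by linarith
qed

end

section \<open>Asymptotic statement and choice of constants\<close>

theorem theorem3:
  fixes A :: "'u paging" and K :: "nat set"
    and \<alpha> :: "nat \<Rightarrow> nat" and \<delta> :: "nat \<Rightarrow> real" and l :: "nat \<Rightarrow> real"
  assumes "paging_algorithm A" and "lazy_paging A" and "stable_paging A"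
    and "\<And>k. k \<in> K \<Longrightarrow> \<alpha> k dvd k \<and> \<alpha> k < k"
    and "\<forall>\<^sub>F k in large_in K.
           \<delta> k \<ge> sqrt (12 * ln (real k / real (\<alpha> k)) / real (\<alpha> k)) \<and> \<delta> k \<le> 1 / 2"
    and "l \<in> O[large_in K](\<lambda>k. exp ((\<delta> k)\<^sup>2 * real (\<alpha> k) / 24))"
  shows "competitive K
           (\<lambda>k. random_hash (k div \<alpha> k))
           (\<lambda>k h \<sigma>. set_assoc_misses A (\<alpha> k) h \<sigma>)
           (misses A)
           1
           (\<lambda>k. 1 - exp (- ((\<delta> k)\<^sup>2 * real (\<alpha> k) / 24)))
           (\<lambda>k. 1 / (1 - \<delta> k))
           l"
proof -
  interpret lazy_stable_paging A using assms(1-3) by unfold_locales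
  obtain C0 where C0: "\<forall>\<^sub>F k in large_in K. norm (l k) \<le> C0 * norm (exp ((\<delta> k)\<^sup>2 * real (\<alpha> k) / 24))"
    using landau_o.bigE[OF assms(6)] by blast
  \<comment> \<open>Positivity allows cancelling \<open>C\<close> in the case of long
    sequences.\<close>
  define C where "C = max C0 1"
  have C: "C \<ge> 1" "C \<ge> C0" by (auto simp: C_def)
  have "\<forall>\<^sub>F k in large_in K. k \<in> K" by (simp add: eventually_inf_principal)
  then have "\<forall>\<^sub>F k in large_in K. \<forall>\<sigma>. real (length \<sigma>) \<le> l k \<longrightarrow>
        measure (random_hash (k div \<alpha> k)) {h \<in> space (random_hash (k div \<alpha> k)).
          real (set_assoc_misses A (\<alpha> k) h \<sigma>)
            \<le> 1 * real (misses A (nat \<lfloor>real k / (1 / (1 - \<delta> k))\<rfloor>) \<sigma>) + C\<^sup>2}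
        \<ge> 1 - exp (- ((\<delta> k)\<^sup>2 * real (\<alpha> k) / 24))"
    using assms(5) C0
  proof (eventually_elim, intro allI impI)
    fix k and \<sigma> :: "'u list"
    assume k: "k \<in> K" and \<delta>: "\<delta> k \<ge> sqrt (12 * ln (real k / real (\<alpha> k)) / real (\<alpha> k)) \<and> \<delta> k \<le> 1 / 2"
      and l: "norm (l k) \<le> C0 * norm (exp ((\<delta> k)\<^sup>2 * real (\<alpha> k) / 24))"
      and len: "real (length \<sigma>) \<le> l k"
    define m where "m = k div \<alpha> k"
    define E where "E = (\<delta> k)\<^sup>2 * real (\<alpha> k) / 24"
    let ?M = "random_hash m :: ('u \<Rightarrow> nat) measure"
    have \<alpha>: "\<alpha> k dvd k" "\<alpha> k < k" using assms(4)[OF k] by auto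
    then have \<alpha>0: "\<alpha> k > 0" by (cases "\<alpha> k = 0") auto
    have km: "k = m * \<alpha> k" using \<alpha>(1) by (simp add: m_def)
    have m2: "m \<ge> 2"
    proof (rule ccontr)
      assume "\<not> m \<ge> 2"
      then have "m = 0 \<or> m = 1" by auto
      then show False using km \<alpha>(2) by auto
    qed
    have km': "real k / real (\<alpha> k) = m"
      using \<alpha>0 by (subst km) simp
    have "sqrt (12 * ln m / \<alpha> k) \<ge> 0" using m2 by simp
    then have \<delta>0: "\<delta> k \<ge> 0" using \<delta> unfolding km' by linarith
    \<comment> \<open>As \<open>(\<delta> k)\<^sup>2 * \<alpha> k\<close> is \<open>24 * E\<close>,
      the lower bound on \<open>\<delta> k\<close> says that there are at most
      \<open>exp (2 * E)\<close> buckets.\<close>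
    have "12 * ln m / \<alpha> k \<le> (\<delta> k)\<^sup>2" using \<delta> unfolding km' by (auto intro: sqrt_le_D)
    then have "ln m \<le> 2 * E" using \<alpha>0 by (simp add: E_def field_simps)
    then have "exp (ln m) \<le> exp (2 * E)" by simp
    then have m_le: "m \<le> exp (2 * E)" using m2 by simp
    have "E \<ge> 0" by (simp add: E_def)
    have len_le: "length \<sigma> \<le> C * exp E"
    proof -
      have "length \<sigma> \<le> C0 * exp E" using l len unfolding E_def by simp
      also have "\<dots> \<le> C * exp E" using C by (intro mult_right_mono) auto
      finally show ?thesis .
    qed
    have "measure ?M {h \<in> space ?M. real (set_assoc_misses A (\<alpha> k) h \<sigma>)
        \<le> 1 * real (misses A (nat \<lfloor>real k / (1 / (1 - \<delta> k))\<rfloor>) \<sigma>) + C\<^sup>2} \<ge> 1 - exp (- E)"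
    proof (cases "length \<sigma> \<le> C\<^sup>2")
      case True
      interpret prob_space ?M using m2 by (intro prob_space_random_hash) auto
      have "real (set_assoc_misses A (\<alpha> k) h \<sigma>) \<le> real n + C\<^sup>2" for h n
        using set_assoc_misses_le_length[of A "\<alpha> k" h \<sigma>] True by linarith
      then show ?thesis using prob_space by simp
    next
      case False
      then have "C * C < C * exp E" using len_le by (simp add: power2_eq_square)
      then have CE: "C < exp E" using C by simp
      \<comment> \<open>The length and the number of buckets each contribute at most
        \<open>2 * E\<close> to the exponent, and a single overflow contributes
        \<open>- 12 * E\<close>. The total \<open>- 8 * E\<close> is below the required
        \<open>- E\<close>.\<close>
      have "real (length \<sigma>) * real m * exp (- ((\<delta> k)\<^sup>2 * \<alpha> k / 2)) \<le> (exp E * exp E) * exp (2 * E) * exp (- (12 * E))"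
      proof (intro mult_mono)
        have "C * exp E \<le> exp E * exp E" using CE by simp
        then show "real (length \<sigma>) \<le> exp E * exp E" using len_le by linarith
        show "exp (- ((\<delta> k)\<^sup>2 * \<alpha> k / 2)) \<le> exp (- (12 * E))" by (simp add: E_def)
      qed (use m_le in auto)
      also have "\<dots> = exp (- 8 * E)" by (simp add: exp_add[symmetric])
      also have "\<dots> \<le> exp (- E)" using \<open>E \<ge> 0\<close> by simp
      finally have bound: "real (length \<sigma>) * real m * exp (- ((\<delta> k)\<^sup>2 * \<alpha> k / 2)) \<le> exp (- E)" .
      have cap: "real k / (1 / (1 - \<delta> k)) = (1 - \<delta> k) * (m * \<alpha> k)" by (subst km) simp
      show ?thesis
        unfolding cap
        using set_assoc_competitive[OF m2 \<alpha>0 \<delta>0 conjunct2[OF \<delta>], of "C\<^sup>2" \<sigma>] bound by simp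
    qed
    then show "measure (random_hash (k div \<alpha> k)) {h \<in> space (random_hash (k div \<alpha> k)).
          real (set_assoc_misses A (\<alpha> k) h \<sigma>)
            \<le> 1 * real (misses A (nat \<lfloor>real k / (1 / (1 - \<delta> k))\<rfloor>) \<sigma>) + C\<^sup>2}
        \<ge> 1 - exp (- ((\<delta> k)\<^sup>2 * real (\<alpha> k) / 24))"
      unfolding m_def E_def .
  qed
  then show ?thesis unfolding competitive_def by blast
qed

end
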